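(* Let $q,z\in\mathbb{C}$ with $|q|<1$ and $z\ne0$. Then $$\sum_{n=0}^\infty\frac{(-1/z;q^2)_{n+1}(-zq^2;q^2)_n}{(-q)_{2n+2}}q^n=\sum_{n=0}^\infty q^{n(n+2)}\sum_{j=-n-1}^{n}z^j.$$
   Context: $(a;p)_n=\prod_{j=1}^{n}(1-ap^{j-1})$ for $n\ge0$ (with $(a;p)_0=1$); when the base is omitted it is $q$: $(a)_n=(a;q)_n$. *)

theory Defs
  imports Complex_Main
begin

definition qpoch :: "complex \<Rightarrow> complex \<Rightarrow> nat \<Rightarrow> complex" where
  "qpoch a p n = (\<Prod>j=1..n. 1 - a * p ^ (j - 1))"

end

theory Submission
  imports Defs "HOL-Analysis.Analysis"
begin

text \<open>
  Write \<open>p = q\<^sup>2\<close> and \<open>P k = (p;p)\<^sub>k\<close>. The finite Jacobi triple product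
  \<open>(-1/z;p)\<^bsub>n+1\<^esub> (-zp;p)\<^sub>n = (\<Sum>j\<le>n. q\<^bsup>j(j+1)\<^esup> P(2n+1)/(P(n-j) P(n+j+1)) (z\<^sup>j + z\<^bsup>-j-1\<^esup>))\<close>
  reduces the identity to a comparison of the coefficients \<open>A j\<close> and \<open>B j\<close> of
  \<open>z\<^sup>j + z\<^bsup>-j-1\<^esup>\<close> on the two sides. On the right, \<open>B j = (\<Sum>n\<ge>j. q\<^bsup>n(n+2)\<^esup>)\<close>, so
  \<open>B j - B (j+1) = q\<^bsup>j(j+2)\<^esup>\<close>. On the left, \<open>A j - A (j+1)\<close> is
  \<open>q\<^bsup>j(j+2)\<^esup>\<close> times a special case of the q-Gauss sum with value 1, which a WZ pair reduces
  to a trivial boundary case. Both \<open>A j\<close> and \<open>B j\<close> tend to 0, so they agree.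
\<close>

section \<open>Finite q-Pochhammer products: nonvanishing and uniform bounds\<close>

lemma qpoch_0 [simp]: "qpoch a p 0 = 1"
  by (simp add: qpoch_def)

lemma qpoch_Suc: "qpoch a p (Suc n) = qpoch a p n * (1 - a * p ^ n)"
  by (simp add: qpoch_def)

text \<open>Factorwise (1 - x)(1 + x) = 1 - x^2. With a = p = q this splits (q^2;q^2)_n into (q;q)_n
  (-q;q)_n, which cancels most of the denominator of the left-hand series.\<close>

lemma qpoch_mult_minus: "qpoch a p n * qpoch (- a) p n = qpoch (a ^ 2) (p ^ 2) n"
  by (induction n) (simp_all add: qpoch_Suc algebra_simps power2_eq_square power_mult_distrib)

lemma one_minus_power_nonzero:
  fixes q :: complex
  assumes "norm q < 1" "k > 0"
  shows "1 - q ^ k \<noteq> 0"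
proof
  assume "1 - q ^ k = 0"
  hence "norm q ^ k = 1" by (simp flip: norm_power)
  moreover have "norm q ^ k < 1" using assms by (simp add: power_less_one_iff)
  ultimately show False by simp
qed

lemma norm_one_minus_power_le:
  fixes q :: complex
  assumes "norm q \<le> 1"
  shows "norm (1 - q ^ k) \<le> 2"
proof -
  have "norm (1 - q ^ k) \<le> 1 + norm q ^ k"
    by (metis norm_one norm_power norm_triangle_ineq4)
  also have "\<dots> \<le> 2" using assms by (simp add: power_le_one)
  finally show ?thesis .
qed

lemma norm_one_plus_power_ge:
  fixes q :: complex
  assumes "norm q < 1" "k > 0"
  shows "norm (1 + q ^ k) \<ge> 1 - norm q"
proof -
  have "norm q ^ k \<le> norm q ^ 1"
    using assms by (intro power_decreasing) auto
  moreover have "norm (1 + q ^ k) \<ge> 1 - norm q ^ k"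
    by (metis norm_diff_ineq norm_one norm_power)
  ultimately show ?thesis by simp
qed

lemma qpoch_self_nonzero:
  fixes q :: complex
  assumes "norm q < 1"
  shows "qpoch q q n \<noteq> 0"
  using one_minus_power_nonzero [OF assms, of "Suc _"] by (induction n) (auto simp: qpoch_Suc)

text \<open>The infinite product of the factors 1 - q^(i+1) converges absolutely, and to a nonzero
  limit because no factor vanishes. Hence the finite products and their reciprocals both converge,
  so both are bounded.\<close>

lemma qpoch_self_bounds:
  fixes q :: complex
  assumes "norm q < 1"
  obtains C where "C > 0" "\<And>n. norm (qpoch q q n) \<le> C" "\<And>n. norm (inverse (qpoch q q n)) \<le> C"
proof -
  define f where "f i = 1 - q ^ Suc i" for i
  have "summable (\<lambda>i. norm (f i - 1))"
    using assms unfolding f_def by (simp add: norm_mult norm_power summable_mult summable_geometric)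
  hence "convergent_prod f"
    using abs_convergent_prod_conv_summable abs_convergent_prod_imp_convergent_prod by blast
  moreover have "f i \<noteq> 0" for i
    unfolding f_def using one_minus_power_nonzero [OF assms] by blast
  ultimately obtain L where L: "(\<lambda>n. \<Prod>i\<le>n. f i) \<longlonglongrightarrow> L" "L \<noteq> 0"
    by (auto simp: convergent_prod_iff_nz_lim)
  have eq: "(\<Prod>i\<le>n. f i) = qpoch q q (Suc n)" for n
    by (induction n) (simp_all add: f_def qpoch_Suc)
  have lim: "(\<lambda>n. qpoch q q n) \<longlonglongrightarrow> L"
    using L(1) unfolding eq by (rule LIMSEQ_imp_Suc)
  have "Bseq (\<lambda>n. qpoch q q n)"
    using lim by (rule convergentI [THEN convergent_imp_Bseq])
  then obtain B where B: "B > 0" "\<And>n. norm (qpoch q q n) \<le> B"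
    by (auto simp: Bseq_def)
  have "Bseq (\<lambda>n. inverse (qpoch q q n))"
    using tendsto_inverse [OF lim L(2)] by (rule convergentI [THEN convergent_imp_Bseq])
  then obtain D where D: "D > 0" "\<And>n. norm (inverse (qpoch q q n)) \<le> D"
    by (auto simp: Bseq_def)
  show ?thesis
    by (rule that [of "max B D"]) (use B D in \<open>auto intro: le_max_iff_disj [THEN iffD2]\<close>)
qed

subsection \<open>A q-Gauss sum\<close>

text \<open>
  For \<open>J > 0\<close> the second branch is the summand. At \<open>J = m = 0\<close> that formula has to be read as
  \<open>(1 - q\<^sup>0) (q;q)\<^bsub>-1\<^esub> = (q;q)\<^sub>0\<close>, while the truncated subtraction would make it 0.
\<close>

definition gauss_term :: "complex \<Rightarrow> nat \<Rightarrow> nat \<Rightarrow> complex" where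
  "gauss_term q J m = (if J = 0 \<and> m = 0 then 1 else
     q ^ m * (1 - q ^ (2 * J)) * qpoch q q (2 * J + 2 * m - 1) /
     (qpoch (q\<^sup>2) (q\<^sup>2) m * qpoch (q\<^sup>2) (q\<^sup>2) (2 * J + m)))"

text \<open>The WZ mate of \<open>gauss_term\<close>. The factor 1 - q^(2m) makes it 0 at m = 0 for
  every J, including J = 0, where the index 2J + 2m - 1 is truncated.\<close>

definition gauss_cert :: "complex \<Rightarrow> nat \<Rightarrow> nat \<Rightarrow> complex" where
  "gauss_cert q J m =
     q ^ (2 * J) * (q ^ (2 * J + 2 * m + 1) * (1 + q ^ (2 * J + 1)) - (1 + q)) *
     q ^ m * (1 - q ^ (2 * m)) * qpoch q q (2 * J + 2 * m - 1) /
     (qpoch (q\<^sup>2) (q\<^sup>2) m * qpoch (q\<^sup>2) (q\<^sup>2) (2 * J + m + 1))"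

text \<open>
  With \<open>x = q\<^bsup>2J\<^esup>\<close>, \<open>y = q\<^bsup>2m\<^esup>\<close>, \<open>w = q\<^sup>m\<close>, \<open>A = (q;q)\<^bsub>2J+2m-1\<^esub>\<close>,
  \<open>D = (q\<^sup>2;q\<^sup>2)\<^sub>m\<close>, \<open>E = (q\<^sup>2;q\<^sup>2)\<^bsub>2J+m\<^esub>\<close>, this is the WZ equation of
  \<open>gauss_term\<close> and \<open>gauss_cert\<close>.
\<close>

lemma wz_identity:
  fixes q x y w A D E :: complex
  assumes "D \<noteq> 0" "E \<noteq> 0" "1 - x\<^sup>2 * y * q\<^sup>2 \<noteq> 0" "1 - x\<^sup>2 * y * q ^ 4 \<noteq> 0" "1 - y * q\<^sup>2 \<noteq> 0"
  shows "w * (1 - x * q\<^sup>2) * (A * (1 - x * y) * (1 - x * y * q)) /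
       (D * (E * (1 - x\<^sup>2 * y * q\<^sup>2) * (1 - x\<^sup>2 * y * q ^ 4))) - w * (1 - x) * A / (D * E) =
     x * (x * y * q ^ 3 * (1 + x * q) - (1 + q)) * (w * q) * (1 - y * q\<^sup>2) *
       (A * (1 - x * y) * (1 - x * y * q)) /
       ((D * (1 - y * q\<^sup>2)) * (E * (1 - x\<^sup>2 * y * q\<^sup>2) * (1 - x\<^sup>2 * y * q ^ 4))) -
     x * (x * y * q * (1 + x * q) - (1 + q)) * w * (1 - y) * A / (D * (E * (1 - x\<^sup>2 * y * q\<^sup>2)))"
proof -
  define a where "a = 1 - x\<^sup>2 * y * q\<^sup>2"
  define b where "b = 1 - x\<^sup>2 * y * q ^ 4"
  have nz: "a \<noteq> 0" "b \<noteq> 0" using assms by (auto simp: a_def b_def)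
  \<comment> \<open>What remains of the claim once the common factor
    \<open>w * A / (D * E * a * b)\<close> is extracted by \<open>t1\<close> to \<open>t4\<close>;
    in \<open>t3\<close>, c = 1 - y q^2 cancels.\<close>
  have key: "(1 - x * q\<^sup>2) * (1 - x * y) * (1 - x * y * q) - (1 - x) * a * b =
     x * (x * y * q ^ 3 * (1 + x * q) - (1 + q)) * q * (1 - x * y) * (1 - x * y * q) -
     x * (x * y * q * (1 + x * q) - (1 + q)) * (1 - y) * b"
    unfolding a_def b_def by algebra
  have t1: "w * (1 - x * q\<^sup>2) * (A * (1 - x * y) * (1 - x * y * q)) / (D * (E * a * b)) =
      w * A / (D * E * a * b) * ((1 - x * q\<^sup>2) * (1 - x * y) * (1 - x * y * q))"
    by (simp add: mult_ac)
  have t2: "w * (1 - x) * A / (D * E) = w * A / (D * E * a * b) * ((1 - x) * a * b)"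
    using nz by simp
  have t3: "K * (w * q) * c * (A * (1 - x * y) * (1 - x * y * q)) / ((D * c) * (E * a * b)) =
      w * A / (D * E * a * b) * (K * q * (1 - x * y) * (1 - x * y * q))" if "c \<noteq> 0" for K c
    using that by (simp add: mult_ac)
  have t4: "K * w * (1 - y) * A / (D * (E * a)) = w * A / (D * E * a * b) * (K * (1 - y) * b)" for K
    using nz by simp
  show ?thesis
    unfolding a_def [symmetric] b_def [symmetric] t1 t2 t3 [OF assms(5)] t4
      right_diff_distrib [symmetric] key ..
qed

text \<open>The right side telescopes in m, so this forces the sum of
  \<open>gauss_term q J m\<close> over m to be the same for all J.\<close>

lemma gauss_term_diff:
  assumes "norm q < 1"
  shows "gauss_term q (Suc J) m - gauss_term q J m = gauss_cert q J (Suc m) - gauss_cert q J m"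
proof (cases "J = 0 \<and> m = 0")
  \<comment> \<open>Here \<open>gauss_term\<close> takes its exceptional value 1, so the equation is
    checked by explicit evaluation.\<close>
  case True
  have "1 - q ^ 2 \<noteq> 0" "1 - q ^ 4 \<noteq> 0" "1 - q \<noteq> 0"
    using one_minus_power_nonzero [OF assms, of 2] one_minus_power_nonzero [OF assms, of 4]
      one_minus_power_nonzero [OF assms, of 1] by simp_all
  hence "(1 - q\<^sup>2) * (1 - q) / ((1 - q\<^sup>2) * (1 - q ^ 4)) - 1 =
      (q ^ 3 * (1 + q) - (1 + q)) * q * (1 - q\<^sup>2) * (1 - q) / ((1 - q\<^sup>2) * ((1 - q\<^sup>2) * (1 - q ^ 4)))"
    by (simp add: divide_simps) algebra
  moreover have "gauss_term q (Suc J) m = (1 - q\<^sup>2) * (1 - q) / ((1 - q\<^sup>2) * (1 - q ^ 4))"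
    "gauss_term q J m = 1" "gauss_cert q J m = 0"
    "gauss_cert q J (Suc m) =
      (q ^ 3 * (1 + q) - (1 + q)) * q * (1 - q\<^sup>2) * (1 - q) / ((1 - q\<^sup>2) * ((1 - q\<^sup>2) * (1 - q ^ 4)))"
    using True by (simp_all add: gauss_term_def gauss_cert_def qpoch_Suc numeral_eq_Suc)
  ultimately show ?thesis by simp
next
  case False
  define k where "k = 2 * J + 2 * m - 1"
  \<comment> \<open>Outside the exceptional case 2J + 2m is positive, so the subtraction in the
    index is not truncated.\<close>
  have k: "2 * J + 2 * m = Suc k" using False by (auto simp: k_def)
  define x where "x = q ^ (2 * J)"
  define y where "y = q ^ (2 * m)"
  let ?P = "qpoch (q\<^sup>2) (q\<^sup>2)"
  have norm_q2: "norm (q\<^sup>2) < 1" using assms by (simp add: norm_power power_less_one_iff)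
  have xy: "q ^ Suc k = x * y"
    by (simp only: x_def y_def power_add [symmetric] k [symmetric])
  have Q: "qpoch q q (Suc (Suc k)) = qpoch q q k * (1 - x * y) * (1 - x * y * q)"
    using xy by (simp add: qpoch_Suc mult_ac)
  have P1: "?P (Suc m) = ?P m * (1 - y * q\<^sup>2)"
    by (simp add: qpoch_Suc y_def mult_ac flip: power_mult)
  have e: "(q\<^sup>2) ^ (2 * J + m) = x\<^sup>2 * y"
    unfolding x_def y_def power_mult [symmetric] power_add [symmetric] by (simp add: algebra_simps)
  have P2: "?P (2 * J + m + 1) = ?P (2 * J + m) * (1 - x\<^sup>2 * y * q\<^sup>2)"
    using e by (simp add: qpoch_Suc mult_ac)
  have P3: "?P (2 * J + m + 2) = ?P (2 * J + m) * (1 - x\<^sup>2 * y * q\<^sup>2) * (1 - x\<^sup>2 * y * q ^ 4)"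
    using e by (simp add: qpoch_Suc mult_ac numeral_eq_Suc)
  have nz: "?P n \<noteq> 0" for n by (rule qpoch_self_nonzero [OF norm_q2])
  have nz': "1 - y * q\<^sup>2 \<noteq> 0" "1 - x\<^sup>2 * y * q\<^sup>2 \<noteq> 0" "1 - x\<^sup>2 * y * q ^ 4 \<noteq> 0"
    using nz [of "Suc m"] nz [of "2 * J + m + 2"] unfolding P1 P3 by auto
  have t1: "gauss_term q (Suc J) m = q ^ m * (1 - x * q\<^sup>2) *
      (qpoch q q k * (1 - x * y) * (1 - x * y * q)) /
      (?P m * (?P (2 * J + m) * (1 - x\<^sup>2 * y * q\<^sup>2) * (1 - x\<^sup>2 * y * q ^ 4)))"
  proof -
    have "2 * Suc J + 2 * m - 1 = Suc (Suc k)" "2 * Suc J + m = 2 * J + m + 2"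
      "q ^ (2 * Suc J) = x * q\<^sup>2"
      using k by (auto simp: x_def power2_eq_square)
    thus ?thesis by (simp only: gauss_term_def Q P3) simp
  qed
  have t2: "gauss_term q J m = q ^ m * (1 - x) * qpoch q q k / (?P m * ?P (2 * J + m))"
    using False by (simp add: gauss_term_def k_def x_def)
  have c1: "gauss_cert q J (Suc m) = x * (x * y * q ^ 3 * (1 + x * q) - (1 + q)) * (q ^ m * q) *
       (1 - y * q\<^sup>2) * (qpoch q q k * (1 - x * y) * (1 - x * y * q)) /
       ((?P m * (1 - y * q\<^sup>2)) * (?P (2 * J + m) * (1 - x\<^sup>2 * y * q\<^sup>2) * (1 - x\<^sup>2 * y * q ^ 4)))"
  proof -
    have "2 * J + 2 * Suc m - 1 = Suc (Suc k)" "2 * J + Suc m + 1 = 2 * J + m + 2"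
      using k by auto
    moreover have "q ^ (2 * Suc m) = y * q\<^sup>2" "q ^ (2 * J + 2 * Suc m + 1) = x * y * q ^ 3"
      "q ^ (2 * J + 1) = x * q" "q ^ Suc m = q ^ m * q"
      by (auto simp: x_def y_def power2_eq_square power_add numeral_eq_Suc)
    ultimately show ?thesis by (simp only: gauss_cert_def Q P1 P3 x_def [symmetric])
  qed
  have c2: "gauss_cert q J m = x * (x * y * q * (1 + x * q) - (1 + q)) * q ^ m * (1 - y) *
       qpoch q q k / (?P m * (?P (2 * J + m) * (1 - x\<^sup>2 * y * q\<^sup>2)))"
  proof -
    have "q ^ (2 * J + 2 * m + 1) = x * y * q" "q ^ (2 * J + 1) = x * q"
      by (auto simp: x_def y_def power_add)
    thus ?thesis by (simp only: gauss_cert_def P2 x_def [symmetric] y_def [symmetric] k_def [symmetric])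
  qed
  show ?thesis unfolding t1 t2 c1 c2
    by (rule wz_identity) (use nz nz' in auto)
qed

lemma gauss_cert_tendsto_0:
  assumes "norm q < 1"
  shows "gauss_cert q J \<longlonglongrightarrow> 0"
proof -
  have norm_q2: "norm (q\<^sup>2) < 1" using assms by (simp add: norm_power power_less_one_iff)
  obtain C where C: "C > 0" "\<And>n. norm (qpoch q q n) \<le> C"
    using qpoch_self_bounds [OF assms] by metis
  obtain D where D: "D > 0" "\<And>n. norm (inverse (qpoch (q\<^sup>2) (q\<^sup>2) n)) \<le> D"
    using qpoch_self_bounds [OF norm_q2] by metis
  have pw: "norm (q ^ k) \<le> 1" for k using assms by (simp add: norm_power power_le_one)
  have pl: "norm (1 + q ^ k) \<le> 2" for k
    using norm_triangle_ineq [of 1 "q ^ k"] pw [of k] by simp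
  \<comment> \<open>Only q^m decays; the other factors are bounded in m. The constant is left
    unsimplified so that \<open>mult_mono\<close> can match it factor by factor.\<close>
  have "norm (gauss_cert q J m) \<le> (1 * (1 * 2 + 2)) * norm q ^ m * 2 * C * (D * D)" for m
  proof -
    have "norm (q ^ (2 * J + 2 * m + 1) * (1 + q ^ (2 * J + 1))) \<le> 1 * 2"
      unfolding norm_mult by (intro mult_mono pw pl) auto
    hence "norm (q ^ (2 * J + 2 * m + 1) * (1 + q ^ (2 * J + 1)) - (1 + q)) \<le> 1 * 2 + 2"
      using pl [of 1] by (intro order_trans [OF norm_triangle_ineq4] add_mono) simp_all
    hence "norm (q ^ (2 * J)) * norm (q ^ (2 * J + 2 * m + 1) * (1 + q ^ (2 * J + 1)) - (1 + q)) *
      norm q ^ m * norm (1 - q ^ (2 * m)) * norm (qpoch q q (2 * J + 2 * m - 1)) *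
      (norm (inverse (qpoch (q\<^sup>2) (q\<^sup>2) m)) * norm (inverse (qpoch (q\<^sup>2) (q\<^sup>2) (2 * J + m + 1))))
      \<le> (1 * (1 * 2 + 2)) * norm q ^ m * 2 * C * (D * D)"
      using assms C D by (intro mult_mono pw norm_one_minus_power_le mult_nonneg_nonneg) auto
    thus ?thesis by (simp add: gauss_cert_def norm_mult norm_divide norm_power norm_inverse divide_inverse)
  qed
  hence "norm (gauss_cert q J m) \<le> norm q ^ m * (8 * C * (D * D))" for m
    by (simp add: mult_ac)
  moreover have "(\<lambda>m. norm q ^ m * (8 * C * (D * D))) \<longlonglongrightarrow> 0"
    using assms by (auto intro!: tendsto_mult_left_zero LIMSEQ_power_zero)
  ultimately show ?thesis
    by (intro Lim_null_comparison [of "gauss_cert q J"]) (auto intro: always_eventually)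
qed

text \<open>For J = 0 the factor 1 - q^(2J) kills every term except m = 0. The step from J to J + 1
  adds a telescoping series of value 0, since the certificate vanishes at m = 0 and as m tends to
  infinity.\<close>

lemma gauss_term_sums:
  assumes "norm q < 1"
  shows "gauss_term q J sums 1"
proof (induction J)
  case 0
  have "gauss_term q 0 = (\<lambda>m. if m = 0 then 1 else 0)"
    by (auto simp: gauss_term_def)
  thus ?case using sums_single [of 0 "\<lambda>_. 1 :: complex"] by simp
next
  case (Suc J)
  have "(\<lambda>m. gauss_cert q J (Suc m) - gauss_cert q J m) sums (0 - gauss_cert q J 0)"
    by (rule telescope_sums [OF gauss_cert_tendsto_0 [OF assms]])
  hence "(\<lambda>m. gauss_term q (Suc J) m - gauss_term q J m) sums 0"
    by (simp add: gauss_term_diff [OF assms] gauss_cert_def)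
  from sums_add [OF this Suc] show ?case by simp
qed


subsection \<open>The finite triple product\<close>

text \<open>This is q^(j(j+1)) times the q^2-binomial coefficient of 2n + 1 over n - j. The value 0
  for j > n lets the recurrences in n hold for all j.\<close>

definition triple_coeff :: "complex \<Rightarrow> nat \<Rightarrow> nat \<Rightarrow> complex" where
  "triple_coeff q n j = (if j \<le> n then q ^ (j * (j + 1)) * qpoch (q\<^sup>2) (q\<^sup>2) (2 * n + 1) /
     (qpoch (q\<^sup>2) (q\<^sup>2) (n - j) * qpoch (q\<^sup>2) (q\<^sup>2) (n + j + 1)) else 0)"

text \<open>The exponents j and -1 - j always carry the same coefficient, so natural indices
  suffice.\<close>

definition sym_power :: "complex \<Rightarrow> nat \<Rightarrow> complex" where
  "sym_power z j = z ^ j + inverse z ^ Suc j"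

text \<open>Keeping n - j in the denominator prepares a common denominator with
  \<open>triple_coeff q n j\<close>. The extra factor vanishes at j = n, in agreement with the
  default value.\<close>

lemma triple_coeff_Suc_right:
  assumes "norm q < 1" "j \<le> n"
  shows "triple_coeff q n (Suc j) = q ^ (Suc j * (j + 2)) * qpoch (q\<^sup>2) (q\<^sup>2) (2 * n + 1) *
     (1 - (q\<^sup>2) ^ (n - j)) / (qpoch (q\<^sup>2) (q\<^sup>2) (n - j) * qpoch (q\<^sup>2) (q\<^sup>2) (n + j + 2))"
proof (cases "j = n")
  case False
  with assms have "n - j = Suc (n - Suc j)" by simp
  moreover have "norm (q\<^sup>2) < 1" using assms by (simp add: norm_power power_less_one_iff)
  hence "1 - (q\<^sup>2) ^ Suc (n - Suc j) \<noteq> 0" by (rule one_minus_power_nonzero) simp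
  ultimately show ?thesis
    using False assms by (simp add: triple_coeff_def qpoch_Suc mult_ac)
qed (simp add: triple_coeff_def)

text \<open>From n to n + 1 the product gains (1 + r/z)(1 + zr) = 1 + r^2 + r(z + 1/z), which
  couples neighbouring indices. The neighbour -1 of index 0 is the mirror image of 0 itself, hence
  \<open>triple_coeff q n 0\<close> in the bracket.\<close>

lemma triple_coeff_rec_0:
  fixes n :: nat
  assumes "norm q < 1"
  defines "r \<equiv> q ^ (2 * n + 2)"
  shows "triple_coeff q (Suc n) 0 =
    (1 + r\<^sup>2) * triple_coeff q n 0 + r * (triple_coeff q n 0 + triple_coeff q n 1)"
proof -
  let ?P = "qpoch (q\<^sup>2) (q\<^sup>2)"
  define D N v where "D = ?P n" and "N = ?P (2 * n + 1)" and "v = q ^ (2 * n)"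
  have norm_q2: "norm (q\<^sup>2) < 1" using assms by (simp add: norm_power power_less_one_iff)
  have nz: "?P n \<noteq> 0" for n by (rule qpoch_self_nonzero [OF norm_q2])
  have r: "r = v * q\<^sup>2" by (simp add: r_def v_def power_add power2_eq_square)
  have rn: "q\<^sup>2 * (q\<^sup>2) ^ n = r"
    unfolding r v_def power_mult by (rule mult.commute)
  have rr: "(q\<^sup>2) ^ (2 * n + 2) = r\<^sup>2"
    unfolding r_def power_mult [symmetric] by (simp add: algebra_simps)
  have P1: "?P (Suc n) = D * (1 - r)"
    by (simp add: qpoch_Suc D_def rn)
  have P2: "?P (n + 2) = D * (1 - r) * (1 - r * q\<^sup>2)"
    by (simp add: qpoch_Suc D_def rn)
  have N2: "?P (2 * n + 3) = N * (1 - r\<^sup>2) * (1 - r\<^sup>2 * q\<^sup>2)"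
    using rr by (simp add: qpoch_Suc N_def mult_ac numeral_3_eq_3)
  have "D \<noteq> 0" "1 - r \<noteq> 0" "1 - r * q\<^sup>2 \<noteq> 0"
    using nz [of "n + 2"] unfolding P2 by auto
  have e0: "triple_coeff q n 0 = N / (D * (D * (1 - r)))"
    by (simp add: triple_coeff_def P1 N_def D_def)
  have e1: "triple_coeff q n 1 = q\<^sup>2 * N * (1 - v) / (D * (D * (1 - r) * (1 - r * q\<^sup>2)))"
  proof -
    have "(q\<^sup>2) ^ n = v" unfolding v_def power_mult ..
    hence "triple_coeff q n (Suc 0) = q ^ (Suc 0 * (0 + 2)) * N * (1 - v) /
        (D * (D * (1 - r) * (1 - r * q\<^sup>2)))"
      using triple_coeff_Suc_right [OF assms(1), of 0 n]
      by (simp only: P2 N_def [symmetric] D_def [symmetric] diff_zero add_0_right le0)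
    thus ?thesis by (simp add: power2_eq_square)
  qed
  have e': "triple_coeff q (Suc n) 0 = N * (1 - r\<^sup>2) * (1 - r\<^sup>2 * q\<^sup>2) /
      (D * (1 - r) * (D * (1 - r) * (1 - r * q\<^sup>2)))"
    using P1 P2 N2 by (simp add: triple_coeff_def numeral_3_eq_3)
  \<comment> \<open>The recurrence divided by the common factor \<open>F\<close> introduced
    below.\<close>
  have key: "(1 + r) * (1 - r\<^sup>2 * q\<^sup>2) = (1 + r\<^sup>2 + r) * (1 - r * q\<^sup>2) + r * q\<^sup>2 * (1 - v)"
    unfolding r by algebra
  define F where "F = N / (D * D * (1 - r) * (1 - r * q\<^sup>2))"
  have "triple_coeff q (Suc n) 0 = F * ((1 + r) * (1 - r\<^sup>2 * q\<^sup>2))"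
  proof -
    have "1 - r\<^sup>2 = (1 - r) * (1 + r)" by algebra
    thus ?thesis using \<open>1 - r \<noteq> 0\<close> unfolding e' F_def by (simp add: mult_ac)
  qed
  moreover have "triple_coeff q n 0 = F * (1 - r * q\<^sup>2)"
    using \<open>1 - r * q\<^sup>2 \<noteq> 0\<close> unfolding e0 F_def by (simp add: mult_ac)
  moreover have "triple_coeff q n 1 = F * (q\<^sup>2 * (1 - v))"
    unfolding e1 F_def by (simp add: mult_ac)
  ultimately show ?thesis unfolding key by (simp only:) (simp add: algebra_simps)
qed

lemma triple_coeff_rec_Suc:
  fixes n :: nat
  assumes "norm q < 1"
  defines "r \<equiv> q ^ (2 * n + 2)"
  shows "triple_coeff q (Suc n) (Suc j) = (1 + r\<^sup>2) * triple_coeff q n (Suc j) +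
    r * (triple_coeff q n j + triple_coeff q n (Suc (Suc j)))"
proof -
  let ?P = "qpoch (q\<^sup>2) (q\<^sup>2)"
  have norm_q2: "norm (q\<^sup>2) < 1" using assms by (simp add: norm_power power_less_one_iff)
  have nz: "?P n \<noteq> 0" for n by (rule qpoch_self_nonzero [OF norm_q2])
  \<comment> \<open>For j > n every term is 0; for j = n only \<open>triple_coeff q n j\<close>
    survives on the right. Otherwise all four coefficients are polynomial multiples of one factor
    \<open>F\<close>.\<close>
  consider "j > n" | "j = n" | "Suc j \<le> n" by linarith
  thus ?thesis
  proof cases
    assume "j > n"
    thus ?thesis by (simp add: triple_coeff_def)
  next
    assume "j = n"
    moreover have "q ^ (Suc n * (n + 2)) = r * q ^ (n * (n + 1))"
      unfolding r_def power_add [symmetric] by (rule arg_cong [of _ _ "(^) q"]) simp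
    ultimately show ?thesis using nz [of "2 * n + 1"] nz [of "2 * Suc n + 1"]
      by (simp add: triple_coeff_def mult_2)
  next
    assume le: "Suc j \<le> n"
    define k where "k = n - Suc j"
    have n: "n = Suc (j + k)" using le by (simp add: k_def)
    define D E N s t u where "D = ?P k" and "E = ?P (n + j + 1)" and "N = ?P (2 * n + 1)"
      and "s = q ^ (j * (j + 1))" and "t = q ^ (2 * j + 2)" and "u = q ^ (2 * k)"
    have r: "r = t * u * q\<^sup>2"
      unfolding r_def t_def u_def power_add [symmetric] by (simp add: n algebra_simps)
    have rr: "(q\<^sup>2) ^ (2 * n + 2) = r\<^sup>2"
      unfolding r_def power_mult [symmetric] by (simp add: algebra_simps)
    have rt: "(q\<^sup>2) ^ (n + j + 2) = r * t"
      unfolding r_def t_def power_mult [symmetric] power_add [symmetric] by (simp add: algebra_simps)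
    have Pk: "?P (Suc k) = D * (1 - u * q\<^sup>2)"
      by (simp add: qpoch_Suc D_def u_def mult_ac flip: power_mult)
    have P2: "?P (n + j + 2) = E * (1 - r * t)"
      using rt by (simp add: qpoch_Suc E_def mult_ac)
    have P3: "?P (n + j + 3) = E * (1 - r * t) * (1 - r * t * q\<^sup>2)"
      proof -
      have "n + j + 3 = Suc (n + j + 2)" by simp
      thus ?thesis by (simp only: qpoch_Suc P2 rt) (simp add: mult_ac)
    qed
    have N2: "?P (2 * n + 3) = N * (1 - r\<^sup>2) * (1 - r\<^sup>2 * q\<^sup>2)"
      using rr by (simp add: qpoch_Suc N_def mult_ac numeral_3_eq_3)
    have nz': "D \<noteq> 0" "E \<noteq> 0" "1 - u * q\<^sup>2 \<noteq> 0" "1 - r * t \<noteq> 0" "1 - r * t * q\<^sup>2 \<noteq> 0"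
      using nz [of "Suc k"] nz [of "n + j + 3"] unfolding P3 Pk by auto
    have s1: "q ^ (Suc j * (j + 2)) = s * t"
      unfolding s_def t_def power_add [symmetric] by (rule arg_cong [of _ _ "(^) q"]) simp
    have s2: "q ^ (Suc (Suc j) * (j + 3)) = s * t\<^sup>2 * q\<^sup>2"
      unfolding s_def t_def power_mult [symmetric] power_add [symmetric]
      by (rule arg_cong [of _ _ "(^) q"]) (simp add: algebra_simps)
    define F where "F = N * s / (D * E * (1 - u * q\<^sup>2) * (1 - r * t) * (1 - r * t * q\<^sup>2))"
    have "triple_coeff q (Suc n) (Suc j) = s * t * (N * (1 - r\<^sup>2) * (1 - r\<^sup>2 * q\<^sup>2)) /
        (D * (1 - u * q\<^sup>2) * (E * (1 - r * t) * (1 - r * t * q\<^sup>2)))"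
    proof -
      have "Suc n - Suc j = Suc k" "Suc n + Suc j + 1 = n + j + 3" "2 * Suc n + 1 = 2 * n + 3"
        "Suc j + 1 = j + 2" "Suc j \<le> Suc n"
        using n by auto
      thus ?thesis by (simp only: triple_coeff_def s1 N2 Pk P3 if_True)
    qed
    hence e': "triple_coeff q (Suc n) (Suc j) = F * (t * (1 - r\<^sup>2) * (1 - r\<^sup>2 * q\<^sup>2))"
      unfolding F_def by (simp add: mult_ac)
    have "triple_coeff q n (Suc j) = s * t * N / (D * (E * (1 - r * t)))"
    proof -
      have "n - Suc j = k" "n + Suc j + 1 = n + j + 2" "Suc j + 1 = j + 2"
        using n by auto
      thus ?thesis using le
        by (simp only: triple_coeff_def s1 P2 if_True D_def [symmetric] N_def [symmetric])
    qed
    hence e1: "triple_coeff q n (Suc j) = F * (t * (1 - u * q\<^sup>2) * (1 - r * t * q\<^sup>2))"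
      using nz' unfolding F_def by simp
    have "triple_coeff q n j = s * N / (D * (1 - u * q\<^sup>2) * E)"
    proof -
      have "n - j = Suc k" "j \<le> n" using n by auto
      thus ?thesis
        by (simp only: triple_coeff_def Pk if_True s_def [symmetric] E_def [symmetric] N_def [symmetric])
    qed
    hence e0: "triple_coeff q n j = F * ((1 - r * t) * (1 - r * t * q\<^sup>2))"
      using nz' unfolding F_def by (simp add: mult_ac)
    have "triple_coeff q n (Suc (Suc j)) =
        s * t\<^sup>2 * q\<^sup>2 * N * (1 - u) / (D * (E * (1 - r * t) * (1 - r * t * q\<^sup>2)))"
    proof -
      have "n - Suc j = k" "n + Suc j + 2 = n + j + 3" "Suc j + 2 = j + 3" "(q\<^sup>2) ^ k = u"
        using n by (auto simp: u_def power_mult)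
      thus ?thesis using triple_coeff_Suc_right [OF assms(1) le]
        by (simp only: s2 P3 D_def [symmetric] N_def [symmetric])
    qed
    hence e2: "triple_coeff q n (Suc (Suc j)) = F * (t\<^sup>2 * q\<^sup>2 * (1 - u) * (1 - u * q\<^sup>2))"
      using nz' unfolding F_def by (simp add: mult_ac)
    have key: "t * (1 - r\<^sup>2) * (1 - r\<^sup>2 * q\<^sup>2) = (1 + r\<^sup>2) * (t * (1 - u * q\<^sup>2) * (1 - r * t * q\<^sup>2)) +
        r * ((1 - r * t) * (1 - r * t * q\<^sup>2) + t\<^sup>2 * q\<^sup>2 * (1 - u) * (1 - u * q\<^sup>2))"
      unfolding r by algebra
    show ?thesis unfolding e' e1 e0 e2 key by (simp add: algebra_simps)
  qed
qed

text \<open>The boundary term vanishes as soon as \<open>e N = e (Suc N) = 0\<close>; keeping it makes the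
  identity provable by induction on \<open>N\<close>.\<close>

lemma sum_sym_power_mult:
  fixes z c r :: complex and e e' :: "nat \<Rightarrow> complex"
  assumes "z \<noteq> 0"
    and "e' 0 = c * e 0 + r * (e 0 + e 1)"
    and "\<And>j. e' (Suc j) = c * e (Suc j) + r * (e j + e (Suc (Suc j)))"
  shows "(\<Sum>j\<le>N. e' j * sym_power z j) =
    (c + r * (z + inverse z)) * (\<Sum>j\<le>N. e j * sym_power z j) +
    r * (e (Suc N) * sym_power z N - e N * sym_power z (Suc N))"
proof -
  \<comment> \<open>The reflection of exponents sends -1 to 0, so the lower neighbour of index 0 is
    again \<open>sym_power z 0\<close>.\<close>
  have w0: "(z + inverse z) * sym_power z 0 = sym_power z 1 + sym_power z 0"
    using assms(1) by (simp add: sym_power_def field_simps)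
  have wS: "(z + inverse z) * sym_power z (Suc j) = sym_power z (Suc (Suc j)) + sym_power z j" for j
    using assms(1) by (simp add: sym_power_def field_simps)
  show ?thesis
  proof (induction N)
    case 0
    show ?case using w0 by (simp add: assms(2)) algebra
  next
    case (Suc N)
    show ?case using wS [of N] Suc by (simp add: assms(3)) algebra
  qed
qed

lemma finite_triple_product:
  assumes "norm q < 1" "z \<noteq> 0"
  shows "qpoch (- 1 / z) (q\<^sup>2) (n + 1) * qpoch (- z * q\<^sup>2) (q\<^sup>2) n =
    (\<Sum>j\<le>n. triple_coeff q n j * sym_power z j)"
proof (induction n)
  case 0
  have "norm (q\<^sup>2) < 1" using assms by (simp add: norm_power power_less_one_iff)
  from qpoch_self_nonzero [OF this, of 1] show ?case
    by (simp add: qpoch_Suc triple_coeff_def sym_power_def divide_inverse)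
next
  case (Suc n)
  define r where "r = q ^ (2 * n + 2)"
  have r: "(q\<^sup>2) ^ (n + 1) = r"
    unfolding r_def power_mult [symmetric] by simp
  have "qpoch (- 1 / z) (q\<^sup>2) (Suc n + 1) * qpoch (- z * q\<^sup>2) (q\<^sup>2) (Suc n) =
    (qpoch (- 1 / z) (q\<^sup>2) (n + 1) * (1 + r * inverse z)) * (qpoch (- z * q\<^sup>2) (q\<^sup>2) n * (1 + z * r))"
    using r by (simp add: qpoch_Suc mult_ac divide_inverse)
  also have "\<dots> = (\<Sum>j\<le>n. triple_coeff q n j * sym_power z j) * ((1 + r * inverse z) * (1 + z * r))"
    unfolding Suc.IH [symmetric] by (simp add: mult_ac)
  also have "(1 + r * inverse z) * (1 + z * r) = (1 + r\<^sup>2) + r * (z + inverse z)"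
    using assms(2) by (simp add: field_simps power2_eq_square)
  \<comment> \<open>The added term is 0. With cutoff \<open>Suc n\<close> both coefficients in the
    boundary term of \<open>sum_sym_power_mult\<close> vanish.\<close>
  also have "(\<Sum>j\<le>n. triple_coeff q n j * sym_power z j) =
      (\<Sum>j\<le>Suc n. triple_coeff q n j * sym_power z j)"
    by (simp add: triple_coeff_def)
  also have "\<dots> * ((1 + r\<^sup>2) + r * (z + inverse z)) =
      (\<Sum>j\<le>Suc n. triple_coeff q (Suc n) j * sym_power z j)"
    using sum_sym_power_mult [OF assms(2), of "triple_coeff q (Suc n)" "1 + r\<^sup>2" "triple_coeff q n" r "Suc n",
        OF triple_coeff_rec_0 [OF assms(1), of n, folded r_def]
          triple_coeff_rec_Suc [OF assms(1), of n, folded r_def]]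
    by (simp add: triple_coeff_def mult.commute)
  finally show ?case .
qed

text \<open>The range of exponents is invariant under j -> -1 - j, and \<open>sym_power\<close>
  collects the resulting pairs.\<close>

lemma sum_powi_symmetric:
  assumes "z \<noteq> 0"
  shows "(\<Sum>j\<in>{- int n - 1..int n}. z powi j) = (\<Sum>j\<le>n. sym_power z j)"
proof (induction n)
  case 0
  have "{- int 0 - 1..int 0} = {-1, 0}" by auto
  thus ?case by (simp add: sym_power_def power_int_minus)
next
  case (Suc n)
  have "{- int (Suc n) - 1..int (Suc n)} =
      insert (- int (Suc (Suc n))) (insert (int (Suc n)) {- int n - 1..int n})"
    by auto
  hence "(\<Sum>j\<in>{- int (Suc n) - 1..int (Suc n)}. z powi j) =
      z powi (- int (Suc (Suc n))) + (z powi int (Suc n) + (\<Sum>j\<in>{- int n - 1..int n}. z powi j))"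
    by (simp del: of_nat_Suc)
  also have "\<dots> = (\<Sum>j\<le>Suc n. sym_power z j)"
    unfolding Suc.IH by (simp only: power_int_minus power_int_of_nat power_inverse)
      (simp add: sym_power_def power_inverse)
  finally show ?case .
qed


subsection \<open>Comparison of the coefficients\<close>

text \<open>By \<open>finite_triple_product\<close>, the coefficient of \<open>sym_power z j\<close>
  in summand n of the left-hand series.\<close>

definition lhs_coeff :: "complex \<Rightarrow> nat \<Rightarrow> nat \<Rightarrow> complex" where
  "lhs_coeff q n j = triple_coeff q n j * q ^ n / qpoch (- q) q (2 * n + 2)"

lemma qpoch_minus_nonzero:
  assumes "norm q < 1"
  shows "qpoch (- q) q n \<noteq> 0"
proof -
  have "norm (q\<^sup>2) < 1" using assms by (simp add: norm_power power_less_one_iff)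
  from qpoch_self_nonzero [OF this] show ?thesis
    by (metis mult_zero_right qpoch_mult_minus)
qed

text \<open>Splitting (q^2;q^2)_(2n+1) cancels all of (-q;q)_(2n+2) except its last factor 1 +
  q^(2n+2).\<close>

lemma lhs_coeff_eq:
  assumes "norm q < 1" "j \<le> n"
  shows "lhs_coeff q n j = q ^ n * q ^ (j * (j + 1)) * qpoch q q (2 * n + 1) /
    ((1 + q ^ (2 * n + 2)) *
      (qpoch (q\<^sup>2) (q\<^sup>2) (n - j) * qpoch (q\<^sup>2) (q\<^sup>2) (n + j + 1)))"
proof -
  have m: "qpoch (- q) q (2 * n + 2) = qpoch (- q) q (2 * n + 1) * (1 + q ^ (2 * n + 2))"
    by (simp add: qpoch_Suc)
  show ?thesis
    using assms qpoch_minus_nonzero [OF assms(1), of "2 * n + 1"]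
    unfolding lhs_coeff_def triple_coeff_def m qpoch_mult_minus [symmetric] if_P [OF assms(2)]
    by (simp add: mult_ac)
qed

text \<open>Over the common factor \<open>F\<close> the difference is (1 - rt) - (t - r) = (1 + r)(1
  - t). The factor 1 + r removes the remaining denominator, and what is left is a q-Gauss
  summand.\<close>

lemma lhs_coeff_diff:
  assumes "norm q < 1" "j \<le> n"
  shows "lhs_coeff q n j - lhs_coeff q n (Suc j) =
    q ^ (j * (j + 2)) * gauss_term q (Suc j) (n - j)"
proof -
  let ?P = "qpoch (q\<^sup>2) (q\<^sup>2)"
  define d where "d = n - j"
  have n: "n = j + d" using assms by (simp add: d_def)
  define D E Q s r t where "D = ?P d" and "E = ?P (n + j + 1)" and "Q = qpoch q q (2 * n + 1)"
    and "s = q ^ n * q ^ (j * (j + 1))" and "r = q ^ (2 * n + 2)" and "t = q ^ (2 * j + 2)"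
  have norm_q2: "norm (q\<^sup>2) < 1" using assms by (simp add: norm_power power_less_one_iff)
  have nz: "?P n \<noteq> 0" for n by (rule qpoch_self_nonzero [OF norm_q2])
  have rt: "(q\<^sup>2) ^ (n + j + 2) = r * t"
    unfolding r_def t_def power_mult [symmetric] power_add [symmetric] by (simp add: algebra_simps)
  have td: "t * (q\<^sup>2) ^ d = r"
    unfolding r_def t_def power_mult [symmetric] power_add [symmetric] by (simp add: n algebra_simps)
  have P2: "?P (n + j + 2) = E * (1 - r * t)"
    using rt by (simp add: qpoch_Suc E_def mult_ac)
  have M: "qpoch (- q) q (2 * n + 2) = qpoch (- q) q (2 * n + 1) * (1 + r)"
    by (simp add: qpoch_Suc r_def)
  have nz': "D \<noteq> 0" "E \<noteq> 0" "1 - r * t \<noteq> 0" "1 + r \<noteq> 0" "qpoch (- q) q (2 * n + 1) \<noteq> 0"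
    using nz [of d] nz [of "n + j + 2"] qpoch_minus_nonzero [OF assms(1), of "2 * n + 2"]
    unfolding P2 M D_def by auto
  define F where "F = s * Q / ((1 + r) * D * E * (1 - r * t))"
  have "lhs_coeff q n j = s * Q / ((1 + r) * (D * E))"
    unfolding lhs_coeff_eq [OF assms] s_def Q_def r_def D_def E_def d_def ..
  hence t1: "lhs_coeff q n j = F * (1 - r * t)"
    using nz' by (simp add: F_def mult_ac)
  have "q ^ (Suc j * (j + 2)) = q ^ (j * (j + 1)) * t"
    unfolding t_def power_add [symmetric] by (rule arg_cong [of _ _ "(^) q"]) simp
  hence "lhs_coeff q n (Suc j) = q ^ (j * (j + 1)) * t * (Q * qpoch (- q) q (2 * n + 1)) *
      (1 - (q\<^sup>2) ^ d) / (D * (E * (1 - r * t))) * q ^ n / (qpoch (- q) q (2 * n + 1) * (1 + r))"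
    unfolding lhs_coeff_def triple_coeff_Suc_right [OF assms] M P2 Q_def D_def d_def
    by (simp only: qpoch_mult_minus)
  moreover have tr: "t - r = t * (1 - (q\<^sup>2) ^ d)"
    using td by (simp add: algebra_simps)
  ultimately have t2: "lhs_coeff q n (Suc j) = F * (t - r)"
    using nz' unfolding tr by (simp add: F_def s_def mult_ac)
  have "q ^ (j * (j + 2)) * q ^ d = s"
    unfolding s_def power_add [symmetric] by (rule arg_cong [of _ _ "(^) q"]) (simp add: n)
  moreover have "gauss_term q (Suc j) d = q ^ d * (1 - t) * Q / (D * (E * (1 - r * t)))"
  proof -
    have "2 * Suc j + 2 * d - 1 = 2 * n + 1" "2 * Suc j + d = n + j + 2"
      using n by auto
    moreover have "q ^ (2 * Suc j) = t" by (simp add: t_def)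
    ultimately show ?thesis unfolding gauss_term_def by (simp only: P2 Q_def D_def) simp
  qed
  ultimately have "q ^ (j * (j + 2)) * gauss_term q (Suc j) d = F * ((1 + r) * (1 - t))"
    using nz' by (simp add: F_def mult_ac)
  thus ?thesis
    unfolding t1 t2 d_def by (simp add: algebra_simps)
qed

lemma lhs_coeff_diff_sums:
  assumes "norm q < 1"
  shows "(\<lambda>n. lhs_coeff q n j - lhs_coeff q n (Suc j)) sums q ^ (j * (j + 2))"
proof -
  have "(\<lambda>m. q ^ (j * (j + 2)) * gauss_term q (Suc j) m) sums (q ^ (j * (j + 2)) * 1)"
    by (rule sums_mult [OF gauss_term_sums [OF assms]])
  hence "(\<lambda>m. lhs_coeff q (m + j) j - lhs_coeff q (m + j) (Suc j)) sums q ^ (j * (j + 2))"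
    using lhs_coeff_diff [OF assms, of j "_ + j"] by simp
  \<comment> \<open>Indices below j contribute nothing, so the shift n = m + j loses no
    terms.\<close>
  moreover have "lhs_coeff q n j - lhs_coeff q n (Suc j) = 0" if "n < j" for n
    using that by (simp add: lhs_coeff_def triple_coeff_def)
  ultimately show ?thesis
    using sums_zero_iff_shift [of j "\<lambda>n. lhs_coeff q n j - lhs_coeff q n (Suc j)"] by simp
qed

text \<open>Separate decay in n and j serves twice: column sums tend to 0, and the double series may
  be rearranged.\<close>

lemma lhs_coeff_bound:
  assumes "norm q < 1"
  obtains C where "\<And>n j. norm (lhs_coeff q n j) \<le> C * norm q ^ n * norm q ^ (j * (j + 1))"
proof -
  have norm_q2: "norm (q\<^sup>2) < 1" using assms by (simp add: norm_power power_less_one_iff)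
  obtain B where B: "B > 0" "\<And>n. norm (qpoch q q n) \<le> B"
    using qpoch_self_bounds [OF assms] by metis
  obtain D where D: "D > 0" "\<And>n. norm (inverse (qpoch (q\<^sup>2) (q\<^sup>2) n)) \<le> D"
    using qpoch_self_bounds [OF norm_q2] by metis
  have "norm (lhs_coeff q n j) \<le> (B * (inverse (1 - norm q) * (D * D))) * norm q ^ n * norm q ^ (j * (j + 1))"
    for n j
  proof (cases "j \<le> n")
    case True
    have "inverse (norm (1 + q ^ (2 * n + 2))) \<le> inverse (1 - norm q)"
      using assms by (intro le_imp_inverse_le norm_one_plus_power_ge) auto
    hence "norm q ^ n * norm q ^ (j * (j + 1)) * (norm (qpoch q q (2 * n + 1)) *
        (inverse (norm (1 + q ^ (2 * n + 2))) * (norm (inverse (qpoch (q\<^sup>2) (q\<^sup>2) (n - j))) *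
          norm (inverse (qpoch (q\<^sup>2) (q\<^sup>2) (n + j + 1))))))
      \<le> norm q ^ n * norm q ^ (j * (j + 1)) * (B * (inverse (1 - norm q) * (D * D)))"
      using assms B D by (intro mult_mono order_refl mult_nonneg_nonneg) auto
    thus ?thesis unfolding lhs_coeff_eq [OF assms True] norm_divide norm_mult norm_power
      by (simp only: divide_inverse inverse_mult_distrib norm_inverse mult_ac)
  next
    case False
    thus ?thesis using assms B D by (simp add: lhs_coeff_def triple_coeff_def)
  qed
  thus ?thesis by (rule that)
qed

section \<open>Column sums determined by their consecutive differences\<close>

lemma summable_column:
  fixes f :: "nat \<Rightarrow> nat \<Rightarrow> complex"
  assumes "0 \<le> a" "a < 1" "\<And>n j. norm (f n j) \<le> C * a ^ n * a ^ (j * (j + 1))"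
  shows "summable (\<lambda>n. f n j)" "(\<lambda>j. \<Sum>n. f n j) \<longlonglongrightarrow> 0"
proof -
  have C: "C \<ge> 0" using order_trans [OF norm_ge_zero assms(3) [of 0 0]] by simp
  have s: "(\<lambda>n. C * a ^ (j * (j + 1)) * a ^ n) sums (C * a ^ (j * (j + 1)) * (1 / (1 - a)))" for j
    using assms by (intro sums_mult geometric_sums) auto
  have b: "norm (f n j) \<le> C * a ^ (j * (j + 1)) * a ^ n" for n j
    using assms(3) [of n j] by (simp add: mult_ac)
  show "summable (\<lambda>n. f n j)"
    by (rule summable_comparison_test' [OF sums_summable [OF s]]) (rule b)
  have "norm (\<Sum>n. f n j) \<le> C / (1 - a) * a ^ j" for j
  proof -
    have "norm (\<Sum>n. f n j) \<le> (\<Sum>n. C * a ^ (j * (j + 1)) * a ^ n)"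
      by (rule norm_suminf_le [OF b sums_summable [OF s]])
    also have "\<dots> = C / (1 - a) * a ^ (j * (j + 1))" using sums_unique [OF s] by simp
    also have "\<dots> \<le> C / (1 - a) * a ^ j"
      using assms C by (intro mult_left_mono power_decreasing) auto
    finally show ?thesis .
  qed
  moreover have "(\<lambda>j. C / (1 - a) * a ^ j) \<longlonglongrightarrow> 0"
    using assms by (intro tendsto_mult_right_zero LIMSEQ_power_zero) auto
  ultimately show "(\<lambda>j. \<Sum>n. f n j) \<longlonglongrightarrow> 0"
    by (intro Lim_null_comparison [of "\<lambda>j. \<Sum>n. f n j"]) (auto intro: always_eventually)
qed

text \<open>Equal consecutive differences make the discrepancy \<open>d\<close> of the column sums
  constant in j; both families of column sums tend to 0, so the constant is 0.\<close>

lemma suminf_column_eq: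
  fixes f g :: "nat \<Rightarrow> nat \<Rightarrow> complex"
  assumes "0 \<le> a" "a < 1"
    and f: "\<And>n j. norm (f n j) \<le> C * a ^ n * a ^ (j * (j + 1))"
    and g: "\<And>n j. norm (g n j) \<le> D * a ^ n * a ^ (j * (j + 1))"
    and df: "\<And>j. (\<lambda>n. f n j - f n (Suc j)) sums s j"
    and dg: "\<And>j. (\<lambda>n. g n j - g n (Suc j)) sums s j"
  shows "(\<Sum>n. f n j) = (\<Sum>n. g n j)"
proof -
  define d where "d j = (\<Sum>n. f n j) - (\<Sum>n. g n j)" for j
  note F = summable_column [OF assms(1,2) f] and G = summable_column [OF assms(1,2) g]
  have fs: "(\<Sum>n. f n j) - (\<Sum>n. f n (Suc j)) = s j" for j
    using df F(1) by (simp add: suminf_diff sums_iff)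
  have gs: "(\<Sum>n. g n j) - (\<Sum>n. g n (Suc j)) = s j" for j
    using dg G(1) by (simp add: suminf_diff sums_iff)
  have "d (Suc j) = d j" for j
  proof -
    have "d (Suc j) = ((\<Sum>n. f n j) - ((\<Sum>n. f n j) - (\<Sum>n. f n (Suc j)))) -
        ((\<Sum>n. g n j) - ((\<Sum>n. g n j) - (\<Sum>n. g n (Suc j))))"
      by (simp add: d_def)
    also have "\<dots> = d j"
      unfolding fs gs by (simp add: d_def)
    finally show ?thesis .
  qed
  hence const: "d j = d 0" for j by (induction j) simp_all
  have "d \<longlonglongrightarrow> 0 - 0" unfolding d_def by (intro tendsto_diff F(2) G(2))
  moreover have "d \<longlonglongrightarrow> d 0"
    by (rule tendsto_eventually) (intro always_eventually allI const)
  ultimately have "d 0 = 0 - 0" by (metis LIMSEQ_unique)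
  with const [of j] have "d j = 0" by (metis diff_0_right)
  thus ?thesis by (simp add: d_def)
qed

section \<open>Theta-type majorants and interchange of summation\<close>

lemma summable_theta:
  fixes a x :: real
  assumes "0 \<le> a" "a < 1" "0 \<le> x"
  shows "summable (\<lambda>j. a ^ (j * (j + 1)) * x ^ j)"
proof -
  \<comment> \<open>The summand equals (x a^(j+1))^j, whose base tends to 0, so a geometric series
    of ratio 1/2 eventually dominates.\<close>
  have "(\<lambda>j. x * a ^ Suc j) \<longlonglongrightarrow> 0"
    using assms by (intro tendsto_mult_right_zero LIMSEQ_Suc LIMSEQ_power_zero) auto
  hence "eventually (\<lambda>j. x * a ^ Suc j < 1 / 2) sequentially"
    by (rule order_tendstoD) simp
  hence "eventually (\<lambda>j. norm (a ^ (j * (j + 1)) * x ^ j) \<le> (1 / 2) ^ j) sequentially"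
  proof eventually_elim
    case (elim j)
    have "a ^ (j * (j + 1)) * x ^ j = (x * a ^ Suc j) ^ j"
      by (simp add: power_mult_distrib mult.commute flip: power_mult power_Suc)
    also have "\<dots> \<le> (1 / 2) ^ j"
      using elim assms by (intro power_mono) auto
    finally show ?case using assms by simp
  qed
  thus ?thesis by (rule summable_comparison_test_ev) (simp add: summable_geometric)
qed

lemma summable_theta_sym_power:
  assumes "0 \<le> a" "a < 1"
  shows "summable (\<lambda>j. a ^ (j * (j + 1)) * norm (sym_power z j))"
proof (rule summable_comparison_test')
  let ?b = "\<lambda>j. a ^ (j * (j + 1)) * norm z ^ j + norm (inverse z) * (a ^ (j * (j + 1)) * norm (inverse z) ^ j)"
  show "summable ?b"
    using assms by (intro summable_add summable_mult summable_theta) auto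
  show "norm (a ^ (j * (j + 1)) * norm (sym_power z j)) \<le> ?b j" for j
  proof -
    have "norm (sym_power z j) \<le> norm z ^ j + norm (inverse z) * norm (inverse z) ^ j"
      unfolding sym_power_def by (rule order_trans [OF norm_triangle_ineq]) (simp add: norm_mult norm_power)
    hence "a ^ (j * (j + 1)) * norm (sym_power z j) \<le>
        a ^ (j * (j + 1)) * (norm z ^ j + norm (inverse z) * norm (inverse z) ^ j)"
      using assms by (intro mult_left_mono) auto
    thus ?thesis using assms by (simp add: algebra_simps)
  qed
qed

text \<open>The product majorant is summable over all pairs, which justifies Fubini; the rows are
  finite because f vanishes above the diagonal.\<close>

lemma triangular_swap:
  fixes f :: "nat \<Rightarrow> nat \<Rightarrow> complex" and a b :: "nat \<Rightarrow> real"
  assumes a: "summable a" "\<And>n. a n \<ge> 0" and b: "summable b" "\<And>j. b j \<ge> 0"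
    and f: "\<And>n j. norm (f n j) \<le> a n * b j" and tri: "\<And>n j. j > n \<Longrightarrow> f n j = 0"
  shows "(\<lambda>n. \<Sum>j\<le>n. f n j) sums (\<Sum>\<^sub>\<infinity>j. \<Sum>n. f n j)"
proof -
  have "(\<lambda>(n, j). a n * b j) summable_on UNIV \<times> UNIV"
  proof (rule summable_on_SigmaI)
    have "(b has_sum suminf b) UNIV"
      using b by (intro sums_nonneg_imp_has_sum) auto
    thus "((\<lambda>j. case (n, j) of (n, j) \<Rightarrow> a n * b j) has_sum a n * suminf b) UNIV" for n
      by (simp add: has_sum_cmult_right)
    show "(\<lambda>n. a n * suminf b) summable_on UNIV"
      using a by (intro summable_on_cmult_left) (simp add: summable_on_UNIV_nonneg_real_iff)
  qed (use a b in auto)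
  hence "(\<lambda>x. norm (case x of (n, j) \<Rightarrow> f n j)) summable_on UNIV \<times> UNIV"
    by (rule Infinite_Sum.abs_summable_on_comparison_test') (use f in auto)
  hence S: "(\<lambda>(n, j). f n j) summable_on UNIV \<times> UNIV"
    by (rule abs_summable_summable)
  have row: "(\<Sum>\<^sub>\<infinity>j. f n j) = (\<Sum>j\<le>n. f n j)" for n
  proof -
    have "(\<Sum>\<^sub>\<infinity>j. f n j) = (\<Sum>\<^sub>\<infinity>j\<in>{..n}. f n j)"
      by (rule infsum_cong_neutral) (auto simp: tri)
    thus ?thesis by simp
  qed
  have column: "(\<Sum>\<^sub>\<infinity>n. f n j) = (\<Sum>n. f n j)" for j
  proof -
    have "summable (\<lambda>n. norm (f n j))"
      by (rule summable_comparison_test' [OF summable_mult2 [OF a(1), of "b j"]]) (simp add: f)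
    from norm_summable_imp_summable_on [OF this] have "((\<lambda>n. f n j) has_sum (\<Sum>\<^sub>\<infinity>n. f n j)) UNIV"
      by (rule has_sum_infsum)
    from has_sum_imp_sums [OF this] show ?thesis by (rule sums_unique)
  qed
  have "(\<lambda>n. \<Sum>\<^sub>\<infinity>j. f n j) summable_on UNIV"
    using summable_on_Sigma_banach [of f UNIV "\<lambda>_. UNIV"] S by simp
  hence "((\<lambda>n. \<Sum>\<^sub>\<infinity>j. f n j) has_sum (\<Sum>\<^sub>\<infinity>n. \<Sum>\<^sub>\<infinity>j. f n j)) UNIV"
    by (rule has_sum_infsum)
  hence "(\<lambda>n. \<Sum>\<^sub>\<infinity>j. f n j) sums (\<Sum>\<^sub>\<infinity>n. \<Sum>\<^sub>\<infinity>j. f n j)"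
    by (rule has_sum_imp_sums)
  also have "(\<Sum>\<^sub>\<infinity>n. \<Sum>\<^sub>\<infinity>j. f n j) = (\<Sum>\<^sub>\<infinity>j. \<Sum>\<^sub>\<infinity>n. f n j)"
    by (rule infsum_swap_banach [OF S])
  finally show ?thesis unfolding row column .
qed

theorem theorem6p2:
  fixes q z :: complex
  assumes "norm q < 1" and "z \<noteq> 0"
  shows "summable (\<lambda>n. qpoch (- 1 / z) (q ^ 2) (n + 1) * qpoch (- z * q ^ 2) (q ^ 2) n
            / qpoch (- q) q (2 * n + 2) * q ^ n) \<and>
    summable (\<lambda>n. q ^ (n * (n + 2)) * (\<Sum>j\<in>{- int n - 1..int n}. z powi j)) \<and>
    (\<Sum>n. qpoch (- 1 / z) (q ^ 2) (n + 1) * qpoch (- z * q ^ 2) (q ^ 2) n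
            / qpoch (- q) q (2 * n + 2) * q ^ n)
    = (\<Sum>n. q ^ (n * (n + 2)) * (\<Sum>j\<in>{- int n - 1..int n}. z powi j))"
proof -
  let ?a = "norm q"
  \<comment> \<open>The coefficient of \<open>sym_power z j\<close> in summand n of the right-hand
    series.\<close>
  define g where "g n j = (if j \<le> n then q ^ (n * (n + 2)) else 0)" for n j :: nat
  obtain C where C: "\<And>n j. norm (lhs_coeff q n j) \<le> C * ?a ^ n * ?a ^ (j * (j + 1))"
    using lhs_coeff_bound [OF assms(1)] by blast
  have C0: "C \<ge> 0" using order_trans [OF norm_ge_zero C [of 0 0]] by simp
  have g: "norm (g n j) \<le> 1 * ?a ^ n * ?a ^ (j * (j + 1))" for n j
  proof (cases "j \<le> n")
    case True
    \<comment> \<open>This exponent comparison gives \<open>g\<close> a bound of the same shape as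
      that of \<open>lhs_coeff\<close>.\<close>
    have "n + j * (j + 1) \<le> n + n * (n + 1)" using True by (intro add_left_mono mult_mono) auto
    also have "\<dots> = n * (n + 2)" by simp
    finally have "?a ^ (n * (n + 2)) \<le> ?a ^ (n + j * (j + 1))"
      using assms(1) by (intro power_decreasing) auto
    thus ?thesis using True by (simp add: g_def norm_mult norm_power power_add)
  qed (simp add: g_def)
  have dg: "(\<lambda>n. g n j - g n (Suc j)) sums q ^ (j * (j + 2))" for j
  proof -
    \<comment> \<open>Consecutive columns differ only at n = j.\<close>
    have "(\<lambda>n. g n j - g n (Suc j)) = (\<lambda>n. if n = j then q ^ (n * (n + 2)) else 0)"
      by (auto simp: g_def)
    thus ?thesis using sums_single [of j "\<lambda>n. q ^ (n * (n + 2))"] by simp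
  qed
  have eq: "(\<Sum>n. lhs_coeff q n j) = (\<Sum>n. g n j)" for j
    by (rule suminf_column_eq [OF _ assms(1) C g lhs_coeff_diff_sums [OF assms(1)] dg]) simp
  have swap: "(\<lambda>n. \<Sum>j\<le>n. h n j * sym_power z j) sums (\<Sum>\<^sub>\<infinity>j. (\<Sum>n. h n j) * sym_power z j)"
    if h: "\<And>n j. norm (h n j) \<le> B * ?a ^ n * ?a ^ (j * (j + 1))" "\<And>n j. j > n \<Longrightarrow> h n j = 0" "B \<ge> 0"
    for h B
  proof -
    have "(\<lambda>n. \<Sum>j\<le>n. h n j * sym_power z j) sums (\<Sum>\<^sub>\<infinity>j. \<Sum>n. h n j * sym_power z j)"
    proof (rule triangular_swap)
      show "summable (\<lambda>n. B * ?a ^ n)" using assms by (intro summable_mult summable_geometric) auto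
      show "summable (\<lambda>j. ?a ^ (j * (j + 1)) * norm (sym_power z j))"
        using assms by (intro summable_theta_sym_power) auto
      show "norm (h n j * sym_power z j) \<le> B * ?a ^ n * (?a ^ (j * (j + 1)) * norm (sym_power z j))"
        for n j
        using mult_right_mono [OF h(1) norm_ge_zero] by (simp add: norm_mult mult.assoc)
    qed (use h in auto)
    moreover have "(\<Sum>n. h n j * sym_power z j) = (\<Sum>n. h n j) * sym_power z j" for j
      using summable_column(1) [OF _ assms(1) h(1)] by (intro suminf_mult2 [symmetric]) simp
    ultimately show ?thesis by simp
  qed
  have "(\<lambda>n. \<Sum>j\<le>n. lhs_coeff q n j * sym_power z j) sums
      (\<Sum>\<^sub>\<infinity>j. (\<Sum>n. lhs_coeff q n j) * sym_power z j)"
    by (rule swap [OF C _ C0]) (simp add: lhs_coeff_def triple_coeff_def)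
  moreover have "(\<Sum>j\<le>n. lhs_coeff q n j * sym_power z j) =
      qpoch (- 1 / z) (q ^ 2) (n + 1) * qpoch (- z * q ^ 2) (q ^ 2) n / qpoch (- q) q (2 * n + 2) * q ^ n" for n
    unfolding finite_triple_product [OF assms] lhs_coeff_def
    by (simp add: sum_divide_distrib sum_distrib_left mult_ac)
  \<comment> \<open>Exchanging the column sums by \<open>eq\<close> gives the left-hand series the
    same value as the right-hand one.\<close>
  ultimately have L: "(\<lambda>n. qpoch (- 1 / z) (q ^ 2) (n + 1) * qpoch (- z * q ^ 2) (q ^ 2) n
            / qpoch (- q) q (2 * n + 2) * q ^ n) sums (\<Sum>\<^sub>\<infinity>j. (\<Sum>n. g n j) * sym_power z j)"
    by (simp only: eq)
  have "(\<lambda>n. \<Sum>j\<le>n. g n j * sym_power z j) sums (\<Sum>\<^sub>\<infinity>j. (\<Sum>n. g n j) * sym_power z j)"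
    by (rule swap [OF g]) (simp_all add: g_def)
  moreover have "(\<Sum>j\<le>n. g n j * sym_power z j) =
      q ^ (n * (n + 2)) * (\<Sum>j\<in>{- int n - 1..int n}. z powi j)" for n
    unfolding sum_powi_symmetric [OF assms(2)] by (simp add: g_def sum_distrib_left)
  ultimately have R: "(\<lambda>n. q ^ (n * (n + 2)) * (\<Sum>j\<in>{- int n - 1..int n}. z powi j)) sums
      (\<Sum>\<^sub>\<infinity>j. (\<Sum>n. g n j) * sym_power z j)"
    by (simp only:)
  from L R show ?thesis by (simp only: sums_iff)
qed

end
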